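(* Let $P(n,k)$ be a magic polygon of $n$ sides and order $k+1$ ($k$ even). Then: (i) the magic sum is $(k+1)\dfrac{k^2n+4}{4}$; (ii) the value corresponding to the root vertex (the central point $C$) is $c=\dfrac{k^2n+4}{4}$; (iii) for each $j\in\{1,\dots,k\}$, the sum $S_j$ of the values corresponding to the $j$-th points, taken clockwise, of all the edges of all the polygons of the magic polygon is $S_j=\dfrac{kn\,(k^2n+4)}{8}$.
   Context: Magic polygon $P(n,k)$: let $\Omega$ be a set of $\frac{k}{2}$ regular polygons in the plane, of different sizes, each with $n$ sides, with corresponding sides parallel and centered at a common central point $C$ (also called the root vertex). A magic polygon $P(n,k)$ of $n$ sides and order $k+1$ is a set of $\frac{k^2n}{2}+1$ points such that: the points are labeled by distinct values from $1$ to $\frac{k^2n}{2}+1$; one of the points is $C$; $\frac{kn}{2}$ of the points are the vertices of the $\frac{k}{2}$ polygons of $\Omega$; there are $k-1$ intermediate points on each edge of each polygon of $\Omega$, for a total of $\frac{(k-1)nk}{2}$ intermediate points; (a) each segment through $C$ whose ends are diametrically opposite points of the largest polygon of $\Omega$ contains $k+1$ points of the magic polygon; (b) each segment whose ends are two adjacent vertices of a polygon of $\Omega$ contains $k+1$ points of the magic polygon; and the sum of the values of the $k+1$ points on each of the segments in (a) and (b) is a fixed value $u$, called the magic sum. Notation for $S_j$: on the $t$-th polygon ($1\le t\le \frac{k}{2}$) the $nk$ points are listed clockwise, and $x_{t,(i-1)k+j}$ is the value of the $j$-th point of the $i$-th edge ($1\le i\le n$, $1\le j\le k$), the point with $j=1$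 being the vertex at which the edge starts. Then $S_j=\sum_{i=1}^{n}\sum_{t=1}^{k/2}x_{t,(i-1)k+j}$.
   Formalization: Condition (a) is taken for points symmetric about C, and every point of the magic polygon on the largest polygon is required to have such an opposite; this forces n to be even. For odd n the claim fails: triangle with vertices 1,2,3, intermediate points 6,4,5, centre 7. *)

theory Defs
  imports "HOL-Analysis.Analysis"
begin

text \<open>The plane is \<^typ>\<open>complex\<close>. The vertices of an n-gon are listed clockwise by
  a function on all of \<^typ>\<open>nat\<close>, hence with period n: the i-th side goes from
  \<^term>\<open>v i\<close> to \<^term>\<open>v (Suc i)\<close> and the n-th side ends at \<^term>\<open>v (Suc n) = v 1\<close>.\<close>

definition regular_polygon :: "nat \<Rightarrow> complex \<Rightarrow> (nat \<Rightarrow> complex) \<Rightarrow> bool" where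
  "regular_polygon n C v \<longleftrightarrow>
     (\<exists>r \<theta> :: real. r > 0 \<and>
        (\<forall>i. v i = C + of_real r * cis (\<theta> - 2 * pi * real i / real n)))"

definition side :: "(nat \<Rightarrow> complex) \<Rightarrow> nat \<Rightarrow> complex set" where
  "side v i = closed_segment (v i) (v (Suc i))"

definition boundary :: "nat \<Rightarrow> (nat \<Rightarrow> complex) \<Rightarrow> complex set" where
  "boundary n v = (\<Union>i\<in>{1..n}. side v i)"

definition circumradius :: "complex \<Rightarrow> (nat \<Rightarrow> complex) \<Rightarrow> real" where
  "circumradius C v = dist C (v 1)"

definition parallel :: "complex \<Rightarrow> complex \<Rightarrow> bool" where
  "parallel a b \<longleftrightarrow> (\<exists>s::real. s \<noteq> 0 \<and> a = s *\<^sub>R b)"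

definition diametrically_opposite :: "complex \<Rightarrow> complex \<Rightarrow> complex \<Rightarrow> bool" where
  "diametrically_opposite C p q \<longleftrightarrow> midpoint p q = C"

text \<open>Here \<^term>\<open>V t\<close>, for t from 1 to k/2, are the polygons, P is the set of points, f the
  labelling and u the magic sum. Corresponding sides of two polygons carry the same number i.
  Neither the spacing of the intermediate points on a side nor the order of the polygons by size
  is fixed.

  Diametrically opposite points are points symmetric about C. The segments of kind (a) are
  those through the points of P on the largest polygon. Assumption \<open>opposite_exists\<close> says that
  each such point is an end of such a segment; it follows from the other assumptions when n is even
  and fails when n is odd (the opposite of a vertex is then not on the polygon). If it were dropped,
  or if points merely collinear with C counted as opposite, then c and u would not be determined
  for odd n.\<close>

locale magic_polygon =
  fixes n k :: nat and C :: complex and V :: "nat \<Rightarrow> nat \<Rightarrow> complex"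
    and P :: "complex set" and f :: "complex \<Rightarrow> nat" and u :: nat
  assumes n_ge_3: "n \<ge> 3"
    and k_pos: "k > 0"
    and k_even: "even k"
    and regular: "\<And>t. t \<in> {1..k div 2} \<Longrightarrow> regular_polygon n C (V t)"
    and different_sizes: "inj_on (\<lambda>t. circumradius C (V t)) {1..k div 2}"
    and parallel_sides: "\<And>s t i. s \<in> {1..k div 2} \<Longrightarrow> t \<in> {1..k div 2} \<Longrightarrow> i \<in> {1..n} \<Longrightarrow>
          parallel (V s (Suc i) - V s i) (V t (Suc i) - V t i)"
    and labels: "bij_betw f P {1..k\<^sup>2 * n div 2 + 1}"
    and root: "C \<in> P"
    and vertices: "\<And>t i. t \<in> {1..k div 2} \<Longrightarrow> i \<in> {1..n} \<Longrightarrow> V t i \<in> P"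
    and intermediate: "\<And>t i. t \<in> {1..k div 2} \<Longrightarrow> i \<in> {1..n} \<Longrightarrow>
          card (P \<inter> open_segment (V t i) (V t (Suc i))) = k - 1"
    and no_other_points: "P \<subseteq> insert C (\<Union>t\<in>{1..k div 2}. boundary n (V t))"
    and opposite_exists: "\<And>t p. is_arg_max (\<lambda>t. circumradius C (V t)) (\<lambda>t. t \<in> {1..k div 2}) t \<Longrightarrow>
          p \<in> P \<inter> boundary n (V t) \<Longrightarrow>
          \<exists>q \<in> boundary n (V t). diametrically_opposite C p q"
    and diameters: "\<And>t p q. is_arg_max (\<lambda>t. circumradius C (V t)) (\<lambda>t. t \<in> {1..k div 2}) t \<Longrightarrow>
          p \<in> P \<inter> boundary n (V t) \<Longrightarrow> q \<in> boundary n (V t) \<Longrightarrow>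
          diametrically_opposite C p q \<Longrightarrow>
          card (P \<inter> closed_segment p q) = k + 1 \<and> (\<Sum>z \<in> P \<inter> closed_segment p q. f z) = u"
    and sides: "\<And>t i. t \<in> {1..k div 2} \<Longrightarrow> i \<in> {1..n} \<Longrightarrow>
          card (P \<inter> side (V t) i) = k + 1 \<and> (\<Sum>z \<in> P \<inter> side (V t) i. f z) = u"

text \<open>\<^term>\<open>pt t ((i - 1) * k + j)\<close> is the j-th point of the i-th side of the t-th polygon, in
  clockwise order. The point with j = 1 is the starting vertex; the end vertex belongs to the
  next side.\<close>

definition clockwise_listing ::
  "nat \<Rightarrow> nat \<Rightarrow> (nat \<Rightarrow> nat \<Rightarrow> complex) \<Rightarrow> complex set \<Rightarrow> (nat \<Rightarrow> nat \<Rightarrow> complex) \<Rightarrow> bool" where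
  "clockwise_listing n k V P pt \<longleftrightarrow>
     (\<forall>t\<in>{1..k div 2}. \<forall>i\<in>{1..n}.
        (\<lambda>j. pt t ((i - 1) * k + j)) ` {1..k} = (P \<inter> side (V t) i) - {V t (Suc i)} \<and>
        strict_mono_on {1..k} (\<lambda>j. dist (V t i) (pt t ((i - 1) * k + j))))"

definition S :: "nat \<Rightarrow> nat \<Rightarrow> (nat \<Rightarrow> nat \<Rightarrow> nat) \<Rightarrow> nat \<Rightarrow> nat" where
  "S n k x j = (\<Sum>i = 1..n. \<Sum>t = 1..k div 2. x t ((i - 1) * k + j))"

end

theory Submission
  imports Defs
begin

text \<open>
  Everything follows from one relation, valid for each position \<open>j \<in> {1..k}\<close> on a side: if
  \<open>L j\<close> is the sum of the labels at position \<open>j\<close> over all sides of all polygons, and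
  \<open>c\<close> is the label of the centre, then \<open>2 * L j = n * (u - c)\<close> (\<open>layer_sum\<close>). It is a double
  count. The diameter through the \<open>j\<close>-th point of the \<open>i\<close>-th side of the largest polygon carries
  the centre and the \<open>j\<close>-th points of the \<open>i\<close>-th sides and of the sides opposite to them, for all
  polygons. Summing the magic sum over all \<open>i\<close> gives \<open>n * u\<close> on one side, and \<open>n * c\<close> together with
  every point at position \<open>j\<close> counted twice on the other.

  Given this relation, three counts determine \<open>u\<close> and \<open>c\<close>. Adding all positions gives the sum
  of all labels, \<open>T = c + k * n * (u - c) / 2\<close>. Adding all sides counts the vertices, that is
  position 1, twice, so \<open>(k / 2) * n * u = (T - c) + L 1\<close>; hence \<open>k * u = (k + 1) * (u - c)\<close> and
  \<open>u = (k + 1) * c\<close>. Finally \<open>T\<close> is the sum of \<open>1, \<dots>, N\<close> with \<open>N = k\<^sup>2 * n / 2 + 1\<close>, while the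
  relations above say \<open>T = c * N\<close>; so \<open>c = (N + 1) / 2\<close>.

  The geometric content is the description of the points on a diameter. The spacing of
  the points on a side is arbitrary, so it has to be shown that all polygons carry the same
  pattern. The existence of opposite points forces \<open>n\<close> to be even. For even \<open>n\<close> a line through
  the centre meets each polygon in at most two points
  (\<open>regular_polygon_line_through_centre\<close>), so at most \<open>k + 1\<close> candidate positions on a
  diameter are available to points of the configuration. As there are exactly \<open>k + 1\<close> such points,
  every candidate is taken (\<open>diameter_points\<close>). Therefore the homothety from the largest polygon to
  any other one, and the reflection in the centre, map the points on sides to points on sides. Both
  scale distances, so they respect the clockwise order and preserve the position \<open>j\<close>
  (\<open>homothety_node\<close>, \<open>reflect_node\<close>).
\<close>
section \<open>Regular polygons\<close>

text \<open>The rotation taking each vertex to the next one; as a root of unity it replaces trigonometry by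
  algebra with powers.\<close>
definition turn :: "nat \<Rightarrow> complex" where
  "turn n = cis (- (2 * pi / real n))"

lemma turn_power: "turn n ^ i = cis (- (2 * pi * real i / real n))"
  unfolding turn_def Complex.DeMoivre by (rule arg_cong[of _ _ cis]) simp

lemma turn_power_period: "n > 0 \<Longrightarrow> turn n ^ n = 1"
  by (simp add: turn_power cis_cnj[symmetric])

lemma turn_power_half: "n > 0 \<Longrightarrow> even n \<Longrightarrow> turn n ^ (n div 2) = -1"
  by (auto simp: turn_power cis_cnj[symmetric] elim!: evenE)

lemma turn_neq_1:
  assumes "n \<ge> 2"
  shows "turn n \<noteq> 1"
proof
  assume "turn n = 1"
  then have "cos (2 * pi / real n) = 1" by (simp add: turn_def complex_eq_iff)
  moreover have "cos (2 * pi / real n) < cos 0"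
    by (rule cos_monotone_0_pi) (use assms in \<open>auto simp: field_simps\<close>)
  ultimately show False by simp
qed

lemma regular_polygon_turn:
  assumes "regular_polygon n C v"
  obtains w where "w \<noteq> 0" "\<And>i. v i = C + w * turn n ^ i"
proof -
  obtain r \<theta> where "r > 0"
    and v: "\<And>i. v i = C + of_real r * cis (\<theta> - 2 * pi * real i / real n)"
    using assms unfolding regular_polygon_def by blast
  have "v i = C + (of_real r * cis \<theta>) * turn n ^ i" for i
    by (simp add: v turn_power mult.assoc cis_mult)
  with \<open>r > 0\<close> show thesis by (intro that[of "of_real r * cis \<theta>"]) auto
qed

lemma regular_polygon_periodic:
  assumes "regular_polygon n C v" "n > 0"
  shows "v (i + n) = v i"
  using regular_polygon_turn[OF assms(1)] assms(2)
  by (metis mult.right_neutral power_add turn_power_period)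

lemma regular_polygon_antipode:
  assumes "regular_polygon n C v" "n > 0" "even n"
  shows "v (i + n div 2) = 2 * C - v i"
proof -
  obtain w where "\<And>i. v i = C + w * turn n ^ i"
    using regular_polygon_turn[OF assms(1)] by metis
  then show ?thesis by (simp add: power_add turn_power_half assms)
qed

lemma regular_polygon_adjacent_distinct:
  assumes "regular_polygon n C v" "n \<ge> 2"
  shows "v i \<noteq> v (Suc i)"
proof -
  obtain w where "w \<noteq> 0" "\<And>i. v i = C + w * turn n ^ i"
    using regular_polygon_turn[OF assms(1)] by metis
  moreover have "turn n ^ i \<noteq> 0" by (simp add: turn_power)
  ultimately show ?thesis using turn_neq_1[OF assms(2)] by simp
qed

lemma regular_polygons_homothetic:
  assumes v: "regular_polygon n C v" and w: "regular_polygon n C w" and n: "n \<ge> 2"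
    and par: "parallel (w (Suc i) - w i) (v (Suc i) - v i)"
  shows "\<exists>a::real. a \<noteq> 0 \<and> (\<forall>j. w j = C + a *\<^sub>R (v j - C))"
proof -
  obtain p where v: "\<And>i. v i = C + p * turn n ^ i"
    using regular_polygon_turn[OF v] by metis
  obtain q where w: "\<And>i. w i = C + q * turn n ^ i"
    using regular_polygon_turn[OF w] by metis
  obtain a :: real where a: "a \<noteq> 0" "w (Suc i) - w i = a *\<^sub>R (v (Suc i) - v i)"
    using par unfolding parallel_def by blast
  have "turn n ^ Suc i - turn n ^ i = turn n ^ i * (turn n - 1)" by (simp add: algebra_simps)
  then have ne: "turn n ^ Suc i - turn n ^ i \<noteq> 0"
    using turn_neq_1[OF n] by (simp add: turn_power)
  have "q * (turn n ^ Suc i - turn n ^ i) = (a *\<^sub>R p) * (turn n ^ Suc i - turn n ^ i)"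
    using a(2) unfolding v w by (simp add: algebra_simps)
  then have "q = a *\<^sub>R p"
    using ne by (simp only: mult_cancel_right) simp
  with a(1) show ?thesis by (auto simp: v w)
qed

text \<open>All vertices, and the reflection of one of them, are at the same distance from the centre, and
  the interior of a side is strictly closer. So the reflection is itself a vertex, and \<open>-1\<close> is a
  quotient of powers of \<open>turn n\<close>, that is an \<open>n\<close>-th root of unity.\<close>
lemma regular_polygon_even_if_antipode:
  assumes "regular_polygon n C v" "n > 0"
    and q: "2 * C - v j \<in> boundary n v"
  shows "even n"
proof -
  obtain w where w: "w \<noteq> 0" and v: "\<And>i. v i = C + w * turn n ^ i"
    using regular_polygon_turn[OF assms(1)] by metis
  have dist_v: "dist C (v i) = norm w" for i
    by (simp add: v dist_norm norm_mult turn_power)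
  have dist_q: "dist C (2 * C - v j) = norm w"
    by (simp add: v dist_norm norm_mult turn_power)
  obtain i where "2 * C - v j \<in> closed_segment (v i) (v (Suc i))"
    using q unfolding boundary_def side_def by blast
  moreover have "2 * C - v j \<notin> open_segment (v i) (v (Suc i))"
    using dist_decreases_open_segment[of "2 * C - v j" "v i" "v (Suc i)" C] dist_v dist_q
    by auto
  ultimately have "\<exists>l. 2 * C - v j = v l"
    unfolding open_segment_def by blast
  then obtain l where "2 * C - v j = v l" ..
  then have "w * - (turn n ^ j) = w * turn n ^ l"
    unfolding v by (simp add: algebra_simps minus_equation_iff[of "w * _"] add_eq_0_iff)
  then have "- (turn n ^ j) = turn n ^ l" using w by (simp only: mult_cancel_left) simp
  then have "(- (turn n ^ j)) ^ n = (turn n ^ l) ^ n" by simp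
  then have "(- 1) ^ n = (1 :: complex)"
    using turn_power_period[OF assms(2)]
    by (simp add: power_minus[of "turn n ^ j"] power_mult[symmetric] mult.commute[of _ n])
      (simp add: power_mult)
  then show ?thesis by (cases "even n") auto
qed

text \<open>An odd integer is not a multiple of an even \<open>n\<close>, so \<open>q * pi / n\<close> stays at distance at
  least \<open>pi / n\<close> from the multiples of \<open>pi\<close>, where the absolute value of the cosine peaks.\<close>
lemma abs_cos_odd_multiple_le:
  fixes q :: int
  assumes "even n" "n > 0" "odd q"
  shows "\<bar>cos (q * pi / real n)\<bar> \<le> cos (pi / real n)"
proof -
  define m where "m = q mod int n"
  have "odd m" unfolding m_def using assms
    by (metis dvd_mod_iff even_of_nat)
  moreover have "0 \<le> m" "m < int n" unfolding m_def using assms by auto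
  ultimately have m: "1 \<le> m" "m \<le> int n - 1" by (cases "m = 0"; simp)+
  have "q = m + (q div int n) * int n" unfolding m_def by simp
  then have "real_of_int q = real_of_int m + real_of_int (q div int n) * real n"
    by (metis of_int_add of_int_mult of_int_of_nat_eq)
  then have "q * pi / real n = m * pi / real n + pi * (q div int n)"
    using assms(2) by (simp add: field_simps)
  then have abs_eq: "\<bar>cos (q * pi / real n)\<bar> = \<bar>cos (m * pi / real n)\<bar>"
    by (simp add: cos_add abs_mult)
  have m': "1 \<le> real_of_int m" "real_of_int m \<le> real n - 1" using m by linarith+
  have "cos (m * pi / real n) \<le> cos (pi / real n)"
    by (rule cos_monotone_0_pi_le) (use m' assms in \<open>auto simp: field_simps\<close>)
  moreover have "cos (pi - pi / real n) \<le> cos (m * pi / real n)"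
    using m' assms(2) mult_left_mono[OF m'(2), of pi]
    by (intro cos_monotone_0_pi_le) (simp_all add: field_simps)
  ultimately show ?thesis unfolding abs_eq by simp
qed

text \<open>A polygon with an even number of sides is a sphere for a norm, the maximum of \<open>\<bar>N l\<bar>\<close> over
  the sides \<open>l\<close>, where \<open>N l\<close> is the component along the outer normal of side \<open>l\<close>. Hence two boundary
  points that are real multiples of each other, seen from the centre, have ratio \<open>1\<close> or \<open>-1\<close>.\<close>
lemma regular_polygon_line_through_centre:
  assumes "regular_polygon n C v" "n \<ge> 3" "even n"
    and p: "p \<in> side v i" and q: "q \<in> side v j"
    and \<mu>: "q - C = \<mu> *\<^sub>R (p - C)"
  shows "\<bar>\<mu>\<bar> = 1"
proof -
  obtain r \<theta> where r: "r > 0"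
    and v: "\<And>i. v i = C + of_real r * cis (\<theta> - 2 * pi * real i / real n)"
    using assms(1) unfolding regular_polygon_def by blast
  \<comment> \<open>the distance of the sides from the centre\<close>
  define a where "a = r * cos (pi / real n)"
  have "a > 0" unfolding a_def
    by (rule mult_pos_pos[OF r], rule cos_gt_zero) (use assms(2) in \<open>auto simp: field_simps\<close>)
  define N where "N l z = Re ((z - C) * cis ((2 * real l + 1) * pi / real n - \<theta>))" for l z
  have N_vertex: "N l (v m) = r * cos (real_of_int (2 * (int l - int m) + 1) * pi / real n)" for l m
  proof -
    have "(\<theta> - 2 * pi * real m / real n) + ((2 * real l + 1) * pi / real n - \<theta>)
        = real_of_int (2 * (int l - int m) + 1) * pi / real n"
      using assms(2) by (simp add: field_simps)
    then show ?thesis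
      unfolding N_def v by (simp add: mult.assoc cis_mult del: of_int_add of_int_mult of_int_diff)
  qed
  have N_convex: "N l ((1 - s) *\<^sub>R x + s *\<^sub>R y) = (1 - s) * N l x + s * N l y" for l s x y
  proof -
    have "(1 - s) *\<^sub>R x + s *\<^sub>R y - C = (1 - s) *\<^sub>R (x - C) + s *\<^sub>R (y - C)"
      by (simp add: algebra_simps)
    then show ?thesis
      unfolding N_def by (simp only: distrib_right mult_scaleR_left plus_complex.sel scaleR_complex.sel)
  qed
  have N_le: "\<bar>N l z\<bar> \<le> a" if z: "z \<in> side v m" for l m z
  proof -
    obtain s where s: "0 \<le> s" "s \<le> 1" and z: "z = (1 - s) *\<^sub>R v m + s *\<^sub>R v (Suc m)"
      using z unfolding side_def in_segment by blast
    have vert: "\<bar>N l (v m')\<bar> \<le> a" for m'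
    proof -
      have "\<bar>cos (real_of_int (2 * (int l - int m') + 1) * pi / real n)\<bar> \<le> cos (pi / real n)"
        by (rule abs_cos_odd_multiple_le) (use assms(2,3) in simp_all)
      then show ?thesis
        unfolding N_vertex a_def abs_mult abs_of_pos[OF r] by (intro mult_left_mono less_imp_le[OF r])
    qed
    have "\<bar>N l z\<bar> \<le> \<bar>(1 - s) * N l (v m)\<bar> + \<bar>s * N l (v (Suc m))\<bar>"
      unfolding z N_convex by (rule abs_triangle_ineq)
    also have "\<dots> \<le> (1 - s) * a + s * a"
      unfolding abs_mult using s vert by (intro add_mono mult_mono) simp_all
    finally show ?thesis by (simp add: left_diff_distrib)
  qed
  have N_side: "N m z = a" if z: "z \<in> side v m" for m z
  proof -
    obtain s where z: "z = (1 - s) *\<^sub>R v m + s *\<^sub>R v (Suc m)"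
      using z unfolding side_def in_segment by blast
    have "N m (v m) = a" "N m (v (Suc m)) = a" by (simp_all add: N_vertex a_def)
    then show ?thesis unfolding z N_convex by (simp add: left_diff_distrib)
  qed
  have N_scale: "N l q = \<mu> * N l p" for l
    unfolding N_def \<mu> by (simp only: mult_scaleR_left scaleR_complex.sel)
  have "a = \<bar>\<mu>\<bar> * \<bar>N j p\<bar>" using N_scale[of j] N_side[OF q] \<open>a > 0\<close>
    by (metis abs_mult abs_of_pos)
  also have "\<dots> \<le> \<bar>\<mu>\<bar> * a" using N_le[OF p] by (intro mult_left_mono) auto
  finally have "1 \<le> \<bar>\<mu>\<bar>" using \<open>a > 0\<close> by simp
  moreover have "\<bar>\<mu>\<bar> * a = \<bar>N i q\<bar>" using N_scale[of i] N_side[OF p] \<open>a > 0\<close>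
    by (simp add: abs_mult)
  then have "\<bar>\<mu>\<bar> * a \<le> a" using N_le[OF q, of i] by simp
  then have "\<bar>\<mu>\<bar> \<le> 1" using \<open>a > 0\<close> by simp
  ultimately show ?thesis by simp
qed

section \<open>Listings in increasing order\<close>

text \<open>The position of an element in an increasing listing depends only on the set listed, since it
  counts the elements below.\<close>
lemma card_below_in_increasing_listing:
  fixes d :: "'a \<Rightarrow> real" and g :: "nat \<Rightarrow> 'a"
  assumes g: "strict_mono_on {1..k} (\<lambda>j. d (g j))" and l: "l \<in> {1..k}"
  shows "card {z \<in> g ` {1..k}. d z < d (g l)} = l - 1"
proof -
  have "{z \<in> g ` {1..k}. d z < d (g l)} = g ` {j \<in> {1..k}. d (g j) < d (g l)}"
    by blast
  also have "{j \<in> {1..k}. d (g j) < d (g l)} = {j \<in> {1..k}. j < l}"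
    using strict_mono_on_less[OF g _ l] by blast
  also have "\<dots> = {1..<l}" using l by auto
  finally have set_eq: "{z \<in> g ` {1..k}. d z < d (g l)} = g ` {1..<l}" .
  have "inj_on (d \<circ> g) {1..k}"
    using strict_mono_on_imp_inj_on[OF g] by (simp add: comp_def)
  then have "inj_on g {1..k}" by (rule inj_on_imageI2)
  then have "inj_on g {1..<l}" by (rule inj_on_subset) (use l in auto)
  then show ?thesis unfolding set_eq by (simp add: card_image)
qed

lemma increasing_listing_unique:
  fixes d :: "'a \<Rightarrow> real" and a b :: "nat \<Rightarrow> 'a"
  assumes img: "a ` {1..k} = b ` {1..k}"
    and a: "strict_mono_on {1..k} (\<lambda>j. d (a j))" and b: "strict_mono_on {1..k} (\<lambda>j. d (b j))"
    and j: "j \<in> {1..k}"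
  shows "a j = b j"
proof -
  obtain l where l: "l \<in> {1..k}" "b j = a l" using img j by blast
  have "j - 1 = card {z \<in> b ` {1..k}. d z < d (b j)}"
    by (rule card_below_in_increasing_listing[where d = d and g = b, OF b j, symmetric])
  also have "\<dots> = l - 1"
    unfolding l(2) img[symmetric] by (rule card_below_in_increasing_listing[where d = d and g = a, OF a l(1)])
  finally have "j = l" using j l(1) unfolding atLeastAtMost_iff by linarith
  with l show ?thesis by simp
qed

section \<open>The points of a magic polygon\<close>

locale listed_magic_polygon = magic_polygon +
  fixes pt :: "nat \<Rightarrow> nat \<Rightarrow> complex"
  assumes listing: "clockwise_listing n k V P pt"
begin

abbreviation node :: "nat \<Rightarrow> nat \<Rightarrow> nat \<Rightarrow> complex" where
  "node t i j \<equiv> pt t ((i - 1) * k + j)"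

text \<open>Vertices are periodic in their index, but the points listed on the sides are only specified for
  the indices \<open>1, \<dots>, n\<close>; hence the index of the side that follows is wrapped around.\<close>
definition next_side :: "nat \<Rightarrow> nat" where
  "next_side i = (if i = n then 1 else Suc i)"

text \<open>Leaving out the end vertex makes the sides of a polygon disjoint: each vertex belongs only to
  the side that starts there.\<close>
definition half_open_side :: "nat \<Rightarrow> nat \<Rightarrow> complex set" where
  "half_open_side t i = P \<inter> side (V t) i - {V t (Suc i)}"

lemma next_side_in: "i \<in> {1..n} \<Longrightarrow> next_side i \<in> {1..n}"
  using n_ge_3 by (auto simp: next_side_def)

lemma vertex_next_side:
  assumes "t \<in> {1..k div 2}"
  shows "V t (next_side i) = V t (Suc i)"
  using regular_polygon_periodic[OF regular[OF assms], of 1] n_ge_3 by (simp add: next_side_def)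

lemma sum_next_side: "(\<Sum>i = 1..n. g (next_side i)) = (\<Sum>i = 1..n. g i :: real)"
  by (rule sum.reindex_bij_witness[where i = "\<lambda>i. if i = 1 then n else i - 1" and j = next_side])
    (use n_ge_3 in \<open>auto simp: next_side_def\<close>)

lemma two_half_k: "2 * (k div 2) = k"
  using k_even by simp

lemma adjacent_distinct: "t \<in> {1..k div 2} \<Longrightarrow> V t i \<noteq> V t (Suc i)"
  using regular_polygon_adjacent_distinct[OF regular] n_ge_3 by simp

lemma end_vertex_in: "t \<in> {1..k div 2} \<Longrightarrow> i \<in> {1..n} \<Longrightarrow> V t (Suc i) \<in> P \<inter> side (V t) i"
  using vertices[of t "next_side i"] vertex_next_side[of t i] next_side_in[of i]
  by (simp add: side_def)

lemma start_vertex_in: "t \<in> {1..k div 2} \<Longrightarrow> i \<in> {1..n} \<Longrightarrow> V t i \<in> half_open_side t i"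
  using vertices[of t i] adjacent_distinct[of t i] by (simp add: half_open_side_def side_def)

lemma node_image:
  assumes "t \<in> {1..k div 2}" "i \<in> {1..n}"
  shows "node t i ` {1..k} = half_open_side t i"
  using listing assms unfolding clockwise_listing_def half_open_side_def by blast

lemma node_in:
  assumes "t \<in> {1..k div 2}" "i \<in> {1..n}" "j \<in> {1..k}"
  shows "node t i j \<in> half_open_side t i"
  using node_image[OF assms(1,2)] assms(3) by blast

lemma node_increasing:
  assumes "t \<in> {1..k div 2}" "i \<in> {1..n}"
  shows "strict_mono_on {1..k} (\<lambda>j. dist (V t i) (node t i j))"
  using listing assms unfolding clockwise_listing_def by blast

text \<open>The starting vertex is among the listed points and has distance 0 from itself, so no point can
  precede it.\<close>
lemma first_node:
  assumes t: "t \<in> {1..k div 2}" and i: "i \<in> {1..n}"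
  shows "node t i 1 = V t i"
proof -
  obtain j where j: "j \<in> {1..k}" "node t i j = V t i"
    using start_vertex_in[OF t i] unfolding node_image[OF t i, symmetric] by force
  have "\<not> 1 < j"
  proof
    assume "1 < j"
    then have "dist (V t i) (node t i 1) < dist (V t i) (node t i j)"
      using strict_mono_onD[OF node_increasing[OF t i], of 1 j] j(1) by simp
    then show False using j(2) by simp
  qed
  then have "j = 1" using j(1) by simp
  with j show ?thesis by simp
qed

lemma finite_P: "finite P"
  using bij_betw_finite[OF labels] by simp

lemma card_P: "card P = k * n * (k div 2) + 1"
proof -
  have "k\<^sup>2 * n div 2 = k * n * (k div 2)"
    using k_even by (auto simp: power2_eq_square elim!: evenE)
  then show ?thesis using bij_betw_same_card[OF labels] by simp
qed

lemma node_cover_subset: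
  "P - {C} \<subseteq> (\<lambda>(t, i, j). node t i j) ` ({1..k div 2} \<times> {1..n} \<times> {1..k})"
proof
  fix z assume z: "z \<in> P - {C}"
  then obtain t i where t: "t \<in> {1..k div 2}" and i: "i \<in> {1..n}" and zs: "z \<in> side (V t) i"
    using no_other_points unfolding boundary_def by blast
  have "\<exists>i' \<in> {1..n}. z \<in> half_open_side t i'"
  proof (cases "z = V t (Suc i)")
    case True
    then show ?thesis
      using start_vertex_in[OF t next_side_in[OF i]] vertex_next_side[OF t] next_side_in[OF i]
      by metis
  next
    case False
    then show ?thesis using z zs i unfolding half_open_side_def by blast
  qed
  then obtain i' where i': "i' \<in> {1..n}" "z \<in> half_open_side t i'" ..
  then obtain j where "j \<in> {1..k}" "z = node t i' j"
    unfolding node_image[OF t i'(1), symmetric] by blast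
  with t i'(1) show "z \<in> (\<lambda>(t, i, j). node t i j) ` ({1..k div 2} \<times> {1..n} \<times> {1..k})"
    by force
qed

text \<open>That the half-open sides share no points and avoid the centre follows by counting: there are
  \<open>(k / 2) * n * k\<close> index triples, just as many as points other than the centre, and they cover all
  these points.\<close>
lemma node_bij:
  "bij_betw (\<lambda>(t, i, j). node t i j) ({1..k div 2} \<times> {1..n} \<times> {1..k}) (P - {C})"
proof -
  let ?I = "{1..k div 2} \<times> {1..n} \<times> {1..k}" and ?g = "\<lambda>(t, i, j). node t i j"
  have card_I: "card ?I = card (P - {C})"
    using root finite_P by (simp add: card_P card_cartesian_product)
  have "card (?g ` ?I) \<le> card ?I" by (rule card_image_le) simp
  then have img: "P - {C} = ?g ` ?I"
    by (intro card_subset_eq[OF _ node_cover_subset] antisym card_mono[OF _ node_cover_subset])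
      (simp_all only: card_I finite_imageI finite_cartesian_product finite_atLeastAtMost)
  moreover have "inj_on ?g ?I"
    by (rule eq_card_imp_inj_on) (simp_all only: img[symmetric] card_I finite_cartesian_product finite_atLeastAtMost)
  ultimately show ?thesis by (simp add: bij_betw_def)
qed

lemma node_neq_centre:
  assumes "t \<in> {1..k div 2}" "i \<in> {1..n}" "j \<in> {1..k}"
  shows "node t i j \<noteq> C"
  using bij_betw_apply[OF node_bij, of "(t, i, j)"] assms by simp

lemma node_eq_iff:
  assumes "t \<in> {1..k div 2}" "i \<in> {1..n}" "j \<in> {1..k}"
    and "t' \<in> {1..k div 2}" "i' \<in> {1..n}" "j' \<in> {1..k}"
  shows "node t i j = node t' i' j' \<longleftrightarrow> t = t' \<and> i = i' \<and> j = j'"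
  using inj_on_eq_iff[OF bij_betw_imp_inj_on[OF node_bij], of "(t, i, j)" "(t', i', j')"] assms
  by simp

text \<open>Both half-open sides have \<open>k\<close> points, so an injective map of one into the other is onto; as
  it scales the distance to the starting vertex, it carries one increasing listing to the other.\<close>
lemma similarity_transports_nodes:
  assumes t: "t \<in> {1..k div 2}" and i: "i \<in> {1..n}" and t': "t' \<in> {1..k div 2}" and i': "i' \<in> {1..n}"
    and c: "c > 0" and sim: "\<And>y z. dist (\<phi> y) (\<phi> z) = c * dist y z"
    and start: "\<phi> (V t i) = V t' i'"
    and side: "\<phi> ` half_open_side t i \<subseteq> half_open_side t' i'"
    and j: "j \<in> {1..k}"
  shows "\<phi> (node t i j) = node t' i' j"
proof -
  have inj: "inj_on (\<lambda>j. \<phi> (node t i j)) {1..k}"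
  proof (rule inj_onI)
    fix j l assume "j \<in> {1..k}" "l \<in> {1..k}" "\<phi> (node t i j) = \<phi> (node t i l)"
    then show "j = l"
      using sim[of "node t i j" "node t i l"] c node_eq_iff[OF t i _ t i] by auto
  qed
  have sub: "(\<lambda>j. \<phi> (node t i j)) ` {1..k} \<subseteq> node t' i' ` {1..k}"
    using side unfolding node_image[OF t i, symmetric] node_image[OF t' i', symmetric] by blast
  have "(\<lambda>j. \<phi> (node t i j)) ` {1..k} = node t' i' ` {1..k}"
  proof (rule card_subset_eq[OF _ sub])
    show "card ((\<lambda>j. \<phi> (node t i j)) ` {1..k}) = card (node t' i' ` {1..k})"
      using card_mono[OF _ sub] card_image_le[of "{1..k}" "node t' i'"] card_image[OF inj] by simp
  qed simp
  then show ?thesis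
  proof (rule increasing_listing_unique[where d = "dist (V t' i')", OF _ _ node_increasing[OF t' i'] j])
    show "strict_mono_on {1..k} (\<lambda>j. dist (V t' i') (\<phi> (node t i j)))"
      using node_increasing[OF t i] c unfolding start[symmetric] sim by (simp add: strict_mono_on_def)
  qed
qed

lemma sum_points:
  fixes g :: "complex \<Rightarrow> real"
  shows "(\<Sum>z\<in>P. g z) = g C + (\<Sum>t = 1..k div 2. \<Sum>i = 1..n. \<Sum>j = 1..k. g (node t i j))"
proof -
  have "(\<Sum>z\<in>P. g z) = g C + (\<Sum>z\<in>P - {C}. g z)"
    by (rule sum.remove[OF finite_P root])
  also have "(\<Sum>z\<in>P - {C}. g z)
      = (\<Sum>(t, i, j)\<in>{1..k div 2} \<times> {1..n} \<times> {1..k}. g (node t i j))"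
    by (simp add: sum.reindex_bij_betw[OF node_bij, symmetric] case_prod_unfold)
  also have "\<dots> = (\<Sum>t = 1..k div 2. \<Sum>i = 1..n. \<Sum>j = 1..k. g (node t i j))"
    by (simp only: sum.cartesian_product)
  finally show ?thesis .
qed

lemma sum_side:
  fixes g :: "complex \<Rightarrow> real"
  assumes t: "t \<in> {1..k div 2}" and i: "i \<in> {1..n}"
  shows "(\<Sum>z\<in>P \<inter> side (V t) i. g z) = (\<Sum>j = 1..k. g (node t i j)) + g (V t (Suc i))"
proof -
  have "inj_on (node t i) {1..k}"
    using node_eq_iff[OF t i _ t i] by (auto simp: inj_on_def)
  then have "(\<Sum>j = 1..k. g (node t i j)) = (\<Sum>z\<in>half_open_side t i. g z)"
    unfolding node_image[OF t i, symmetric] by (simp add: sum.reindex)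
  moreover have "(\<Sum>z\<in>P \<inter> side (V t) i. g z) = g (V t (Suc i)) + (\<Sum>z\<in>half_open_side t i. g z)"
    unfolding half_open_side_def
    by (rule sum.remove) (use end_vertex_in[OF t i] finite_P in auto)
  ultimately show ?thesis by simp
qed

section \<open>Diameters\<close>

text \<open>Diameters are given only for the points on the largest polygon, so every other polygon is
  compared with it.\<close>
definition outer :: nat where
  "outer = (SOME t. is_arg_max (\<lambda>t. circumradius C (V t)) (\<lambda>t. t \<in> {1..k div 2}) t)"

lemma outer: "is_arg_max (\<lambda>t. circumradius C (V t)) (\<lambda>t. t \<in> {1..k div 2}) outer"
proof -
  let ?R = "(\<lambda>t. circumradius C (V t)) ` {1..k div 2}"
  have "{1..k div 2} \<noteq> {}" using k_pos k_even by auto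
  then have "Max ?R \<in> ?R" by (intro Max_in) simp_all
  then obtain t where t: "t \<in> {1..k div 2}" "circumradius C (V t) = Max ?R" by auto
  have "circumradius C (V s) \<le> circumradius C (V t)" if "s \<in> {1..k div 2}" for s
    unfolding t(2) using that by simp
  with t(1) have "is_arg_max (\<lambda>t. circumradius C (V t)) (\<lambda>t. t \<in> {1..k div 2}) t"
    unfolding is_arg_max_def by force
  then show ?thesis unfolding outer_def by (rule someI)
qed

lemma outer_in: "outer \<in> {1..k div 2}"
  using outer unfolding is_arg_max_def by blast

lemma node_in_boundary:
  assumes t: "t \<in> {1..k div 2}" and i: "i \<in> {1..n}" and j: "j \<in> {1..k}"
  shows "node t i j \<in> P \<inter> boundary n (V t)"
  using node_in[OF t i j] i unfolding half_open_side_def boundary_def by blast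

lemma opposite_iff: "diametrically_opposite C p q \<longleftrightarrow> q = 2 * C - p"
  unfolding diametrically_opposite_def midpoint_def
  by (auto simp: complex_eq_iff field_simps)

lemma reflected_node_in_boundary:
  assumes "i \<in> {1..n}" "j \<in> {1..k}"
  shows "2 * C - node outer i j \<in> boundary n (V outer)"
  using opposite_exists[OF outer node_in_boundary[OF outer_in assms]]
  unfolding opposite_iff by blast

lemma diameter:
  assumes "i \<in> {1..n}" "j \<in> {1..k}"
  shows "card (P \<inter> closed_segment (node outer i j) (2 * C - node outer i j)) = k + 1"
    and "(\<Sum>z\<in>P \<inter> closed_segment (node outer i j) (2 * C - node outer i j). f z) = u"
  using diameters[OF outer node_in_boundary[OF outer_in assms] reflected_node_in_boundary[OF assms]]
  by (simp_all add: opposite_iff)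

text \<open>A vertex of the largest polygon has an opposite point on that polygon.\<close>
lemma n_even: "even n"
proof (rule regular_polygon_even_if_antipode[OF regular[OF outer_in]])
  show "2 * C - V outer 1 \<in> boundary n (V outer)"
    using reflected_node_in_boundary[of 1 1] first_node[OF outer_in, of 1] n_ge_3 k_pos by simp
qed (use n_ge_3 in simp)

text \<open>The ratio of the homothety with centre \<open>C\<close> that takes the vertices of the largest polygon to those
  of the \<open>t\<close>-th, with their numbering. It is negative if corresponding sides lie on opposite sides of \<open>C\<close>:
  parallelism of the sides allows this.\<close>
definition scale :: "nat \<Rightarrow> real" where
  "scale t = (SOME a. a \<noteq> 0 \<and> (\<forall>i. V t i = C + a *\<^sub>R (V outer i - C)))"

lemma scale:
  assumes t: "t \<in> {1..k div 2}"
  shows "scale t \<noteq> 0" and "V t i = C + scale t *\<^sub>R (V outer i - C)"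
proof -
  have "\<exists>a::real. a \<noteq> 0 \<and> (\<forall>i. V t i = C + a *\<^sub>R (V outer i - C))"
    by (rule regular_polygons_homothetic[OF regular[OF outer_in] regular[OF t], where i = 1])
      (use parallel_sides[OF t outer_in, of 1] n_ge_3 in simp_all)
  from someI_ex[OF this] show "scale t \<noteq> 0" "V t i = C + scale t *\<^sub>R (V outer i - C)"
    unfolding scale_def by blast+
qed

lemma scale_outer: "scale outer = 1"
proof -
  have "V outer 1 \<noteq> C"
    using first_node[OF outer_in, of 1] node_neq_centre[OF outer_in, of 1 1] n_ge_3 k_pos by simp
  moreover have "(1 - scale outer) *\<^sub>R (V outer 1 - C) = 0"
    using scale(2)[OF outer_in, of 1] by (simp add: algebra_simps)
  ultimately show ?thesis by simp
qed

definition homothety :: "nat \<Rightarrow> complex \<Rightarrow> complex" where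
  "homothety t z = C + scale t *\<^sub>R (z - C)"

lemma homothety_vertex: "t \<in> {1..k div 2} \<Longrightarrow> homothety t (V outer i) = V t i"
  using scale(2) by (simp add: homothety_def)

lemma homothety_eq_iff: "t \<in> {1..k div 2} \<Longrightarrow> homothety t y = homothety t z \<longleftrightarrow> y = z"
  using scale(1) by (simp add: homothety_def)

lemma homothety_side:
  assumes t: "t \<in> {1..k div 2}"
  shows "homothety t ` side (V outer) i = side (V t) i"
proof -
  have "homothety t = (\<lambda>z. (C - scale t *\<^sub>R C) + z) \<circ> (\<lambda>z. scale t *\<^sub>R z)"
    by (rule ext) (simp add: homothety_def algebra_simps)
  then have "homothety t ` closed_segment a b = closed_segment (homothety t a) (homothety t b)" for a b
    by (simp only: image_comp[symmetric] closed_segment_linear_image[OF linear_scaleR, symmetric]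
        closed_segment_translation comp_apply)
  then show ?thesis by (simp add: side_def homothety_vertex[OF t])
qed

lemma dist_homothety: "dist (homothety t y) (homothety t z) = \<bar>scale t\<bar> * dist y z"
  by (simp add: homothety_def dist_norm scaleR_right_diff_distrib[symmetric])

text \<open>A point of the diameter other than the centre is the image under some \<open>homothety t\<close> of a boundary
  point \<open>b\<close> of the largest polygon, and \<open>b\<close> lies on the line through \<open>p\<close> and \<open>C\<close>. That line meets
  the boundary only in \<open>p\<close> and the point opposite to it.\<close>
lemma diameter_subset:
  assumes i: "i \<in> {1..n}" and j: "j \<in> {1..k}"
  defines "p \<equiv> node outer i j"
  shows "P \<inter> closed_segment p (2 * C - p)
    \<subseteq> insert C ((\<lambda>t. homothety t p) ` {1..k div 2} \<union> (\<lambda>t. homothety t (2 * C - p)) ` {1..k div 2})"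
proof
  fix z assume z: "z \<in> P \<inter> closed_segment p (2 * C - p)"
  show "z \<in> insert C ((\<lambda>t. homothety t p) ` {1..k div 2} \<union> (\<lambda>t. homothety t (2 * C - p)) ` {1..k div 2})"
  proof (cases "z = C")
    case False
    then obtain t l where t: "t \<in> {1..k div 2}" and l: "l \<in> {1..n}" and "z \<in> side (V t) l"
      using no_other_points z unfolding boundary_def by blast
    then obtain b where b: "b \<in> side (V outer) l" and zb: "z = homothety t b"
      unfolding homothety_side[OF t, symmetric] by blast
    obtain s where "z = (1 - s) *\<^sub>R p + s *\<^sub>R (2 * C - p)"
      using z unfolding Int_iff in_segment by blast
    then have "scale t *\<^sub>R (b - C) = (1 - 2 * s) *\<^sub>R (p - C)"
      using zb by (simp add: homothety_def scaleR_conv_of_real algebra_simps)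
    then have ratio: "b - C = ((1 - 2 * s) / scale t) *\<^sub>R (p - C)"
      using scale(1)[OF t] by (simp add: eq_vector_fraction_iff)
    have "p \<in> side (V outer) i"
      using node_in[OF outer_in i j] unfolding half_open_side_def p_def by blast
    from regular_polygon_line_through_centre[OF regular[OF outer_in] n_ge_3 n_even this b ratio]
    have "b = p \<or> b = 2 * C - p"
      using ratio by (auto simp: abs_if algebra_simps split: if_splits)
    then show ?thesis using t zb by blast
  qed simp
qed

text \<open>The right-hand side has at most \<open>1 + 2 * (k / 2)\<close> elements, and the diameter contains that many
  points of \<open>P\<close>. This is where the diameters force the same spacing on all polygons.\<close>
lemma diameter_points:
  assumes i: "i \<in> {1..n}" and j: "j \<in> {1..k}"
  defines "p \<equiv> node outer i j"
  shows "P \<inter> closed_segment p (2 * C - p)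
    = insert C ((\<lambda>t. homothety t p) ` {1..k div 2} \<union> (\<lambda>t. homothety t (2 * C - p)) ` {1..k div 2})"
    (is "?D = insert C (?A \<union> ?B)")
proof (rule card_subset_eq)
  show "?D \<subseteq> insert C (?A \<union> ?B)" unfolding p_def by (rule diameter_subset[OF i j])
  show fin: "finite (insert C (?A \<union> ?B))" by simp
  have "card ?A \<le> k div 2" "card ?B \<le> k div 2" by (simp_all add: card_image_le[THEN order_trans])
  then have "card (?A \<union> ?B) \<le> k" using card_Un_le[of ?A ?B] two_half_k by linarith
  then have "card (insert C (?A \<union> ?B)) \<le> k + 1"
    using card_insert_le_m1[of "k + 1" "?A \<union> ?B" C] by simp
  also have "k + 1 = card ?D" unfolding p_def by (rule diameter(1)[OF i j, symmetric])
  finally show "card ?D = card (insert C (?A \<union> ?B))"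
    using card_mono[OF fin \<open>?D \<subseteq> _\<close>] by linarith
qed

text \<open>The homothety maps points of the largest polygon to points on diameters, which belong to \<open>P\<close> by
  \<open>diameter_points\<close>.\<close>
lemma homothety_node:
  assumes t: "t \<in> {1..k div 2}" and i: "i \<in> {1..n}" and j: "j \<in> {1..k}"
  shows "homothety t (node outer i j) = node t i j"
proof (rule similarity_transports_nodes[OF outer_in i t i _ dist_homothety homothety_vertex[OF t] _ j])
  show "\<bar>scale t\<bar> > 0" using scale(1)[OF t] by simp
  show "homothety t ` half_open_side outer i \<subseteq> half_open_side t i"
  proof
    fix z assume "z \<in> homothety t ` half_open_side outer i"
    then obtain l where l: "l \<in> {1..k}" and z: "z = homothety t (node outer i l)"
      unfolding node_image[OF outer_in i, symmetric] by blast
    have "z \<in> P" unfolding z using diameter_points[OF i l] t by blast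
    moreover have "z \<in> side (V t) i"
      using node_in[OF outer_in i l] unfolding z homothety_side[OF t, symmetric] half_open_side_def by blast
    moreover have "z \<noteq> V t (Suc i)"
      using node_in[OF outer_in i l] homothety_eq_iff[OF t]
      unfolding z homothety_vertex[OF t, symmetric] half_open_side_def by blast
    ultimately show "z \<in> half_open_side t i" unfolding half_open_side_def by blast
  qed
qed

definition opposite_side :: "nat \<Rightarrow> nat" where
  "opposite_side i = (if i \<le> n div 2 then i + n div 2 else i - n div 2)"

lemma opposite_side_in: "i \<in> {1..n} \<Longrightarrow> opposite_side i \<in> {1..n}"
  using n_even by (auto simp: opposite_side_def elim!: evenE)

lemma opposite_side_neq: "opposite_side i \<noteq> i"
  using n_ge_3 by (auto simp: opposite_side_def)

lemma sum_opposite_side: "(\<Sum>i = 1..n. g (opposite_side i)) = (\<Sum>i = 1..n. g i :: real)"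
  by (rule sum.reindex_bij_witness[where i = opposite_side and j = opposite_side])
    (use n_even in \<open>auto simp: opposite_side_def elim!: evenE\<close>)

lemma vertex_opposite_side:
  assumes "i \<in> {1..n}"
  shows "V outer (opposite_side i) = 2 * C - V outer i"
    and "V outer (Suc (opposite_side i)) = 2 * C - V outer (Suc i)"
proof -
  have half: "V outer (l + n div 2) = 2 * C - V outer l" for l
    using regular_polygon_antipode[OF regular[OF outer_in] _ n_even] n_ge_3 by simp
  have "V outer (opposite_side i) = 2 * C - V outer i
    \<and> V outer (Suc (opposite_side i)) = 2 * C - V outer (Suc i)"
  proof (cases "i \<le> n div 2")
    case True
    then show ?thesis using half[of i] half[of "Suc i"] by (simp add: opposite_side_def)
  next
    case False
    then have "opposite_side i + n div 2 = i" by (simp add: opposite_side_def)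
    then have "V outer i = 2 * C - V outer (opposite_side i)"
      and "V outer (Suc i) = 2 * C - V outer (Suc (opposite_side i))"
      using half[of "opposite_side i"] half[of "Suc (opposite_side i)"] by (simp_all only: add_Suc)
    then show ?thesis by simp
  qed
  then show "V outer (opposite_side i) = 2 * C - V outer i"
    and "V outer (Suc (opposite_side i)) = 2 * C - V outer (Suc i)" by blast+
qed

lemma reflect_outer_side:
  assumes i: "i \<in> {1..n}"
  shows "(\<lambda>z. 2 * C - z) ` side (V outer) i = side (V outer) (opposite_side i)"
proof -
  have "(\<lambda>z. 2 * C - z) ` closed_segment a b = closed_segment (2 * C - a) (2 * C - b)" for a b
  proof -
    have "(\<lambda>z. 2 * C - z) ` closed_segment a b = (+) (2 * C) ` uminus ` closed_segment a b"
      by (simp add: image_image)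
    also have "\<dots> = closed_segment (2 * C + - a) (2 * C + - b)"
      by (simp only: closed_segment_linear_image[OF linear_uminus] closed_segment_translation)
    finally show ?thesis by simp
  qed
  then show ?thesis unfolding side_def vertex_opposite_side[OF i] .
qed

lemma reflect_node:
  assumes i: "i \<in> {1..n}" and j: "j \<in> {1..k}"
  shows "2 * C - node outer i j = node outer (opposite_side i) j"
proof (rule similarity_transports_nodes[OF outer_in i outer_in opposite_side_in[OF i], of 1 "\<lambda>z. 2 * C - z"])
  show "dist (2 * C - y) (2 * C - z) = 1 * dist y z" for y z
    by (simp add: dist_norm norm_minus_commute)
  show "2 * C - V outer i = V outer (opposite_side i)"
    by (simp add: vertex_opposite_side[OF i])
  show "(\<lambda>z. 2 * C - z) ` half_open_side outer i \<subseteq> half_open_side outer (opposite_side i)"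
  proof
    fix z assume "z \<in> (\<lambda>z. 2 * C - z) ` half_open_side outer i"
    then obtain l where l: "l \<in> {1..k}" and z: "z = 2 * C - node outer i l"
      unfolding node_image[OF outer_in i, symmetric] by blast
    \<comment> \<open>brings the reflected point to the form in which \<open>diameter_points\<close> lists it\<close>
    have "2 * C - node outer i l = homothety outer (2 * C - node outer i l)"
      by (simp add: homothety_def scale_outer)
    then have "z \<in> P" unfolding z using diameter_points[OF i l] outer_in by blast
    moreover have "z \<in> side (V outer) (opposite_side i)"
      using node_in[OF outer_in i l] unfolding z reflect_outer_side[OF i, symmetric] half_open_side_def
      by blast
    moreover have "z \<noteq> V outer (Suc (opposite_side i))"
      using node_in[OF outer_in i l] unfolding z vertex_opposite_side[OF i] half_open_side_def by simp
    ultimately show "z \<in> half_open_side outer (opposite_side i)" unfolding half_open_side_def by blast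
  qed
qed (use j in simp_all)

section \<open>Double counting\<close>

definition layer_sum :: "nat \<Rightarrow> real" where
  "layer_sum j = (\<Sum>i = 1..n. \<Sum>t = 1..k div 2. real (f (node t i j)))"

lemma diameter_sum:
  assumes i: "i \<in> {1..n}" and j: "j \<in> {1..k}"
  shows "real u = f C + (\<Sum>t = 1..k div 2. real (f (node t i j)))
    + (\<Sum>t = 1..k div 2. real (f (node t (opposite_side i) j)))"
proof -
  let ?A = "(\<lambda>t. node t i j) ` {1..k div 2}"
    and ?B = "(\<lambda>t. node t (opposite_side i) j) ` {1..k div 2}"
  note i' = opposite_side_in[OF i]
  have D: "P \<inter> closed_segment (node outer i j) (2 * C - node outer i j) = insert C (?A \<union> ?B)"
  proof -
    have "(\<lambda>t. homothety t (node outer i j)) ` {1..k div 2} = ?A"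
      by (rule image_cong[OF refl]) (rule homothety_node[OF _ i j])
    moreover have "(\<lambda>t. homothety t (2 * C - node outer i j)) ` {1..k div 2} = ?B"
      unfolding reflect_node[OF i j] by (rule image_cong[OF refl]) (rule homothety_node[OF _ i' j])
    ultimately show ?thesis unfolding diameter_points[OF i j] by simp
  qed
  have "C \<notin> ?A \<union> ?B" unfolding Un_iff image_iff
    using node_neq_centre[OF _ i j] node_neq_centre[OF _ i' j] by metis
  moreover have "?A \<inter> ?B = {}"
    using node_eq_iff[OF _ i j _ i' j] opposite_side_neq[of i] by auto
  moreover have "inj_on (\<lambda>t. node t i j) {1..k div 2}" "inj_on (\<lambda>t. node t (opposite_side i) j) {1..k div 2}"
    using node_eq_iff[OF _ i j _ i j] node_eq_iff[OF _ i' j _ i' j] by (auto simp: inj_on_def)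
  moreover have "real u = (\<Sum>z\<in>insert C (?A \<union> ?B). real (f z))"
    using diameter(2)[OF i j] unfolding D by (simp only: of_nat_sum[symmetric])
  ultimately show ?thesis by (simp add: sum.union_disjoint sum.reindex)
qed

text \<open>Passing to the opposite side permutes the sides, so both sums in \<open>diameter_sum\<close> add up to the
  same total.\<close>
lemma layer_sum:
  assumes j: "j \<in> {1..k}"
  shows "2 * layer_sum j = n * (real u - f C)"
proof -
  have "n * real u = (\<Sum>i = 1..n. real u)" by simp
  also have "\<dots> = (\<Sum>i = 1..n. f C + (\<Sum>t = 1..k div 2. real (f (node t i j)))
    + (\<Sum>t = 1..k div 2. real (f (node t (opposite_side i) j))))"
    by (rule sum.cong) (use diameter_sum j in simp_all)
  also have "\<dots> = n * real (f C) + layer_sum j + layer_sum j"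
    unfolding sum.distrib layer_sum_def
      sum_opposite_side[of "\<lambda>i. \<Sum>t = 1..k div 2. real (f (node t i j))"] by simp
  finally show ?thesis by (simp add: algebra_simps)
qed

lemma sum_labels:
  "(\<Sum>z\<in>P. real (f z)) = real (f C) + (\<Sum>j = 1..k. layer_sum j)"
proof -
  have "(\<Sum>j = 1..k. layer_sum j) = (\<Sum>i = 1..n. \<Sum>j = 1..k. \<Sum>t = 1..k div 2. real (f (node t i j)))"
    unfolding layer_sum_def by (rule sum.swap)
  also have "\<dots> = (\<Sum>i = 1..n. \<Sum>t = 1..k div 2. \<Sum>j = 1..k. real (f (node t i j)))"
    by (rule sum.cong[OF refl], rule sum.swap)
  also have "\<dots> = (\<Sum>t = 1..k div 2. \<Sum>i = 1..n. \<Sum>j = 1..k. real (f (node t i j)))"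
    by (rule sum.swap)
  finally show ?thesis unfolding sum_points by simp
qed

lemma sum_labels_value:
  "2 * (\<Sum>z\<in>P. real (f z)) = (real k ^ 2 * n / 2 + 1) * (real k ^ 2 * n / 2 + 2)"
proof -
  define M where "M = k\<^sup>2 * n div 2 + 1"
  have M: "real M = real k ^ 2 * n / 2 + 1"
    unfolding M_def using k_even by (auto simp: power2_eq_square elim!: evenE)
  have "(\<Sum>z\<in>P. real (f z)) = (\<Sum>m = 1..M. real m)"
    unfolding M_def by (rule sum.reindex_bij_betw[OF labels])
  also have "2 * \<dots> = real M * (real M + 1)"
    using double_gauss_sum_from_Suc_0[of M, where 'a = real] by simp
  finally show ?thesis unfolding M by (simp add: algebra_simps)
qed

text \<open>The sides of all polygons cover each point other than \<open>C\<close> once, and each vertex a second time,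
  as the end of the preceding side.\<close>
lemma side_sums:
  "real (k div 2) * n * real u = (\<Sum>j = 1..k. layer_sum j) + layer_sum 1"
proof -
  have "real (k div 2) * n * real u = (\<Sum>t = 1..k div 2. \<Sum>i = 1..n. real u)" by simp
  also have "\<dots> = (\<Sum>t = 1..k div 2. \<Sum>i = 1..n.
      (\<Sum>j = 1..k. real (f (node t i j))) + real (f (node t (next_side i) 1)))"
  proof (intro sum.cong refl)
    fix t i assume t: "t \<in> {1..k div 2}" and i: "i \<in> {1..n}"
    have "real u = (\<Sum>z\<in>P \<inter> side (V t) i. real (f z))"
      using sides[OF t i] by (simp only: of_nat_sum[symmetric])
    also have "\<dots> = (\<Sum>j = 1..k. real (f (node t i j))) + real (f (V t (Suc i)))"
      by (rule sum_side[OF t i])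
    also have "V t (Suc i) = node t (next_side i) 1"
      using first_node[OF t next_side_in[OF i]] vertex_next_side[OF t] by simp
    finally show "real u = (\<Sum>j = 1..k. real (f (node t i j))) + real (f (node t (next_side i) 1))" .
  qed
  also have "\<dots> = ((\<Sum>z\<in>P. real (f z)) - f C) + (\<Sum>t = 1..k div 2. \<Sum>i = 1..n. real (f (node t i 1)))"
    unfolding sum.distrib sum_points
      sum_next_side[of "\<lambda>i. real (f (node t i 1))" for t] by simp
  also have "\<dots> = (\<Sum>j = 1..k. layer_sum j) + layer_sum 1"
    unfolding layer_sum_def[of 1] by (subst sum.swap) (simp add: sum_labels)
  finally show ?thesis .
qed

lemma magic_values:
  shows "real u = (real k + 1) * f C"
    and "real (f C) = (real k ^ 2 * n + 4) / 4"
    and "\<And>j. j \<in> {1..k} \<Longrightarrow> layer_sum j = real k * n * f C / 2"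
proof -
  define c where "c = real (f C)"
  have n0: "real n > 0" using n_ge_3 by simp
  have k0: "real k > 0" using k_pos by simp
  have layer: "layer_sum j = n * (real u - c) / 2" if "j \<in> {1..k}" for j
    using layer_sum[OF that] by (simp add: c_def)
  then have layers: "(\<Sum>j = 1..k. layer_sum j) = k * (n * (real u - c) / 2)"
    by (subst sum.cong[OF refl layer]) simp_all
  have half: "real (k div 2) = k / 2" using k_even by auto
  have first: "layer_sum 1 = n * (real u - c) / 2" by (rule layer) (use k_pos in simp)
  have "real k / 2 * n * u = k * (n * (real u - c) / 2) + n * (real u - c) / 2"
    using side_sums unfolding half layers first .
  then have "n * (k * real u) = n * ((real k + 1) * (real u - c))" by (simp add: field_simps)
  then have "k * real u = (real k + 1) * (real u - c)" using n0 by simp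
  then have u: "real u = (real k + 1) * c" by (simp add: algebra_simps)
  then show "real u = (real k + 1) * f C" by (simp add: c_def)
  have diff: "real u - c = k * c" using u by (simp add: algebra_simps)
  have "(\<Sum>z\<in>P. real (f z)) = c * (real k ^ 2 * n / 2 + 1)"
    unfolding sum_labels layers diff c_def[symmetric] by (simp add: power2_eq_square algebra_simps)
  then have "(real k ^ 2 * n / 2 + 1) * (2 * c) = (real k ^ 2 * n / 2 + 1) * (real k ^ 2 * n / 2 + 2)"
    using sum_labels_value by (simp only: mult_ac)
  moreover have "real k ^ 2 * n / 2 + 1 \<noteq> 0"
    using add_nonneg_pos[of "real k ^ 2 * n / 2" 1] by simp
  ultimately have "2 * c = real k ^ 2 * n / 2 + 2" by (simp only: mult_cancel_left) simp
  then show "real (f C) = (real k ^ 2 * n + 4) / 4" by (simp add: c_def)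
  show "layer_sum j = real k * n * f C / 2" if "j \<in> {1..k}" for j
    unfolding layer[OF that] diff c_def[symmetric] by simp
qed

end

theorem theorem1:
  fixes n k :: nat and C :: complex and V :: "nat \<Rightarrow> nat \<Rightarrow> complex"
    and P :: "complex set" and f :: "complex \<Rightarrow> nat" and u :: nat
    and pt :: "nat \<Rightarrow> nat \<Rightarrow> complex" and x :: "nat \<Rightarrow> nat \<Rightarrow> nat"
  assumes "magic_polygon n k C V P f u"
    and "clockwise_listing n k V P pt"
    and "\<And>t m. t \<in> {1..k div 2} \<Longrightarrow> m \<in> {1..n * k} \<Longrightarrow> x t m = f (pt t m)"
  shows "real u = (real k + 1) * ((real k)\<^sup>2 * real n + 4) / 4 \<and>
         real (f C) = ((real k)\<^sup>2 * real n + 4) / 4 \<and>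
         (\<forall>j\<in>{1..k}. real (S n k x j) = real k * real n * ((real k)\<^sup>2 * real n + 4) / 8)"
proof -
  interpret listed_magic_polygon n k C V P f u pt
    using assms(1,2) by (simp add: listed_magic_polygon_def listed_magic_polygon_axioms_def)
  have "real (S n k x j) = real k * real n * ((real k)\<^sup>2 * real n + 4) / 8"
    if j: "j \<in> {1..k}" for j
  proof -
    have "x t ((i - 1) * k + j) = f (node t i j)" if t: "t \<in> {1..k div 2}" and i: "i \<in> {1..n}" for t i
    proof (rule assms(3)[OF t])
      have "(i - 1) * k + j \<le> (i - 1) * k + k" using j by simp
      also have "\<dots> = i * k" using i by (cases i) simp_all
      also have "\<dots> \<le> n * k" using i by simp
      finally show "(i - 1) * k + j \<in> {1..n * k}" using j by simp
    qed
    then have "real (S n k x j) = layer_sum j"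
      by (simp add: S_def layer_sum_def)
    then show ?thesis using magic_values(2) magic_values(3)[OF j] by simp
  qed
  then show ?thesis using magic_values(1,2) by simp
qed

end
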